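(* Let $(A;*,\bullet,\{a_n\})$ be a marked Kauffman bracket magma satisfying the following conditions: (1) $a_n=a_{n+2}$ for all $n\in\mathbb{N}$; (2) $(a*b)\bullet(c*d)=(a\bullet c)*(b\bullet d)$ for all $a,b,c,d\in A$. Then $P_M:\mathcal{F}\to A$ is invariant under all Yoshikawa moves except $\Gamma_1,\Gamma_6$ and $\Gamma_6'$; that is, it is invariant under $\Gamma_2,\Gamma_3,\Gamma_4,\Gamma_4',\Gamma_5,\Gamma_7,\Gamma_8$.
   Context: Algebra. $\mathbb{N}=\{1,2,3,\dots\}$. A magma $(A;\star)$ is entropic if $(a\star b)\star(c\star d)=(a\star c)\star(b\star d)$ for all $a,b,c,d\in A$. A Kauffman bracket magma $(A;*,\{a_n\})$ is an entropic magma $(A;* )$ with a sequence $\{a_n\}_{n=1}^\infty$ in $A$ such that for all $n\in\mathbb{N}$: $(a_{n+1}*a_{n+2})*(a_n*a_{n+1})=a_n$ and $(a_n*a_{n+1})*(a_{n+1}*a_n)=a_{n+1}$. A marked Kauffman bracket magma $(A;*,\bullet,\{a_n\})$ is a Kauffman bracket magma $(A;*,\{a_n\})$ with a further binary operation $\bullet$ on $A$ such that $(A;\bullet)$ is entropic. The invariant $P$. For an unoriented link diagram $D$ with a chosen crossing, $D_0$ is the result of the $A$-smoothing (joining the two regions swept out when the overstrand is rotated counterclockwise) and $D_\infty$ that of the other smoothing. By a theorem of Niebrzydowski–Przytycki, there is a unique $A$-valued function $P$ of unoriented link diagrams, invariant under planar isotopy and Reidemeister moves II and III, with $P(T_n)=a_n$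 for the crossingless diagram $T_n$ with $n$ components and $P(D)=P(D_0)*P(D_\infty)$ at every crossing. Marked graph diagrams. A marked graph diagram is a link diagram in $\mathbb{R}^2$ that may in addition have 4-valent marked vertices, each decorated by a marker, a short segment through the vertex lying in two opposite of the four adjacent corner regions. Splicing a marked vertex $m$ of $D$ means: $D^m_\infty$ is obtained by the smoothing that merges the two corner regions containing the ends of the marker, $D^m_0$ by the other smoothing. Applying the $\infty$-smoothing (resp. the $0$-smoothing) at all marked vertices gives the positive resolution $L_+(D)$ (resp. negative resolution $L_-(D)$). $D$ is admissible if both $L_+(D)$ and $L_-(D)$ are diagrams of trivial links. $\mathcal{F}$ is the set of admissible marked graph diagrams. The function $P_M$. It is defined (recursively, on all marked graph diagrams and hence on $\mathcal{F}$) by $P_M(D)=P(D)$ if $D$ has no markers, and $P_M(D)=P_M(D^m_\infty)\bullet P_M(D^m_0)$ for any marked vertex $m$ of $D$; the value is independent of the order in which markers are spliced. Invariance under a move means $P_M(D)=P_M(D')$ whenever $D,D'\in\mathcal{F}$ differ by planar isotopy or by one application of the move. Yoshikawa moves (local, in a disc). $\Gamma_1,\Gamma_2,\Gamma_3$: Reidemeister moves I, II, III at classical crossings. $\Gamma_4$ (resp. $\Gamma_4'$): an arc passing over (resp. under) two adjacent edges at a marked vertex is slid across the vertex so as to pass over (resp. under) the other two edges. $\Gamma_5$: a marked vertex (marker horizontal or vertical) whose two left-hand edges cross each other once is replaced by the same marked vertex whose two right-hand edges cross each other once, the new crossing being a translate of the old. $\Gamma_6$: a marked vertex two cyclically adjacent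 edges of which are joined into a small loop bounding an otherwise empty disc, such that the $\infty$-smoothing yields an arc and a separate small circle, is replaced by a simple arc; $\Gamma_6'$: the same with the $0$-smoothing yielding an arc and a circle. $\Gamma_7$: consider 3-tangles with three vertical strand positions; let $V_1$ have one marked vertex in positions 1,2 (position 3 straight) whose $\infty$-smoothing is the identity tangle, and let $W_2$ have one marked vertex in positions 2,3 (position 1 straight) whose $0$-smoothing is the identity tangle; $\Gamma_7$ replaces $V_1$ stacked on $W_2$ by $W_2$ stacked on $V_1$. $\Gamma_8$: consider a horizontal pair of parallel strands crossing a vertical pair of parallel strands in four classical crossings; insert a marked vertex between the two horizontal strands near one end, whose $\infty$-smoothing continues the two strands in parallel, and a marked vertex between the two vertical strands near one end, whose $0$-smoothing continues the two strands in parallel; $\Gamma_8$ replaces the 4-tangle in which the horizontal pair is entirely over the vertical pair by the one in which all four crossings are changed. Each move may be applied in either direction. *)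

theory Defs
  imports Main
begin

section \<open>Marked Kauffman bracket magmas\<close>

text \<open>The underlying set of the magma is a whole type; the sequence is only used at indices
  \<open>n \<ge> 1\<close>.\<close>

definition entropic :: "('a \<Rightarrow> 'a \<Rightarrow> 'a) \<Rightarrow> bool" where
  "entropic f \<longleftrightarrow> (\<forall>a b c d. f (f a b) (f c d) = f (f a c) (f b d))"

definition Kauffman_bracket_magma :: "('a \<Rightarrow> 'a \<Rightarrow> 'a) \<Rightarrow> (nat \<Rightarrow> 'a) \<Rightarrow> bool" where
  "Kauffman_bracket_magma star a \<longleftrightarrow> entropic star \<and>
     (\<forall>n\<ge>1. star (star (a (n+1)) (a (n+2))) (star (a n) (a (n+1))) = a n \<and>
            star (star (a n) (a (n+1))) (star (a (n+1)) (a n)) = a (n+1))"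

definition marked_Kauffman_bracket_magma ::
    "('a \<Rightarrow> 'a \<Rightarrow> 'a) \<Rightarrow> ('a \<Rightarrow> 'a \<Rightarrow> 'a) \<Rightarrow> (nat \<Rightarrow> 'a) \<Rightarrow> bool" where
  "marked_Kauffman_bracket_magma star bullet a \<longleftrightarrow>
     Kauffman_bracket_magma star a \<and> entropic bullet"


section \<open>Marked graph diagrams\<close>

text \<open>
  A diagram in the plane is presented in Morse position with respect to the height function: it is
  cut by horizontal lines into slices, listed from bottom to top, each containing exactly one
  elementary piece and otherwise only vertical strands. A layer \<open>(x, i)\<close> is the piece \<open>x\<close> with
  exactly \<open>i\<close> vertical strands to its left. Every diagram is planar isotopic to one of this form.

  \<^item> \<open>Cup\<close>: a local minimum (no strands enter from below, two leave above);
    \<open>Cap\<close>: a local maximum.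
  \<^item> \<open>Over_NE\<close>, \<open>Over_NW\<close>: the classical crossing whose overstrand runs from the bottom left to the
    top right, respectively from the bottom right to the top left.
  \<^item> \<open>Mark_H\<close>, \<open>Mark_V\<close>: a marked vertex with two edges leaving below and two above. The ends of the
    marker lie in the left and right corner regions (\<open>Mark_H\<close>, horizontal marker), respectively in
    the bottom and top ones (\<open>Mark_V\<close>, vertical marker).
\<close>

datatype piece = Cup | Cap | Over_NE | Over_NW | Mark_H | Mark_V

type_synonym layer = "piece \<times> nat"

fun strands_in :: "piece \<Rightarrow> nat" where
  "strands_in Cup = 0"
| "strands_in _ = 2"

fun strands_out :: "piece \<Rightarrow> nat" where
  "strands_out Cap = 0"
| "strands_out _ = 2"

definition is_crossing :: "piece \<Rightarrow> bool" where
  "is_crossing x \<longleftrightarrow> x = Over_NE \<or> x = Over_NW"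

definition is_marked :: "piece \<Rightarrow> bool" where
  "is_marked x \<longleftrightarrow> x = Mark_H \<or> x = Mark_V"

text \<open>\<open>tangle m w n\<close>: the slices fit together to a tangle with \<open>m\<close> bottom and \<open>n\<close> top ends.\<close>

fun tangle :: "nat \<Rightarrow> layer list \<Rightarrow> nat \<Rightarrow> bool" where
  "tangle m [] n \<longleftrightarrow> m = n"
| "tangle m ((x, i) # w) n \<longleftrightarrow>
     i + strands_in x \<le> m \<and> tangle (m - strands_in x + strands_out x) w n"

definition marked_graph_diagram :: "layer list \<Rightarrow> bool" where
  "marked_graph_diagram D \<longleftrightarrow> tangle 0 D 0"

definition link_diagram :: "layer list \<Rightarrow> bool" where
  "link_diagram D \<longleftrightarrow> marked_graph_diagram D \<and> (\<forall>(x, i) \<in> set D. \<not> is_marked x)"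

text \<open>The crossingless diagram of \<open>n\<close> disjoint circles.\<close>

definition circles :: "nat \<Rightarrow> layer list" where
  "circles n = concat (replicate n [(Cup, 0), (Cap, 0)])"


subsection \<open>Smoothings\<close>

text \<open>
  A crossing or marked vertex is replaced either by two vertical strands (which merges its bottom
  and top regions) or by a cap below a cup (which merges its left and right regions).
\<close>

abbreviation vertical :: "layer list" where
  "vertical \<equiv> []"

abbreviation turnback :: "nat \<Rightarrow> layer list" where
  "turnback i \<equiv> [(Cap, i), (Cup, i)]"

text \<open>
  Rotating the overstrand of \<open>Over_NE\<close> counterclockwise sweeps out the bottom and top regions, that
  of \<open>Over_NW\<close> the left and right ones. The infinity-smoothing of a marked vertex merges the
  regions containing the ends of the marker. The values on \<open>Cup\<close> and \<open>Cap\<close> are irrelevant.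
\<close>

fun zero_smoothing :: "piece \<Rightarrow> nat \<Rightarrow> layer list" where
  "zero_smoothing Over_NE i = vertical"
| "zero_smoothing Over_NW i = turnback i"
| "zero_smoothing Mark_H i = vertical"
| "zero_smoothing Mark_V i = turnback i"
| "zero_smoothing x i = [(x, i)]"

fun infty_smoothing :: "piece \<Rightarrow> nat \<Rightarrow> layer list" where
  "infty_smoothing Over_NE i = turnback i"
| "infty_smoothing Over_NW i = vertical"
| "infty_smoothing Mark_H i = turnback i"
| "infty_smoothing Mark_V i = vertical"
| "infty_smoothing x i = [(x, i)]"

definition positive_resolution :: "layer list \<Rightarrow> layer list" where
  "positive_resolution D =
     concat (map (\<lambda>(x, i). if is_marked x then infty_smoothing x i else [(x, i)]) D)"

definition negative_resolution :: "layer list \<Rightarrow> layer list" where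
  "negative_resolution D =
     concat (map (\<lambda>(x, i). if is_marked x then zero_smoothing x i else [(x, i)]) D)"


subsection \<open>Planar isotopy\<close>

text \<open>\<open>local_change R D D'\<close>: \<open>D'\<close> arises from \<open>D\<close> by replacing one subtangle \<open>l\<close> by \<open>r\<close>, where
  \<open>R l r\<close>.\<close>

definition local_change ::
    "(layer list \<Rightarrow> layer list \<Rightarrow> bool) \<Rightarrow> layer list \<Rightarrow> layer list \<Rightarrow> bool" where
  "local_change R D D' \<longleftrightarrow> marked_graph_diagram D \<and> marked_graph_diagram D' \<and>
     (\<exists>u v l r. R l r \<and> D = u @ l @ v \<and> D' = u @ r @ v)"

text \<open>Effect of a rotation by 90 degrees on crossings and marked vertices.\<close>

fun quarter_turn :: "piece \<Rightarrow> piece" where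
  "quarter_turn Over_NE = Over_NW"
| "quarter_turn Over_NW = Over_NE"
| "quarter_turn Mark_H = Mark_V"
| "quarter_turn Mark_V = Mark_H"
| "quarter_turn x = x"

text \<open>
  Diagrams in Morse position are planar isotopic iff they are related by a sequence of the
  following changes: exchanging the heights of two pieces lying side by side; cancelling or creating
  a neighbouring minimum and maximum on a strand; and turning a crossing or marked vertex by 90
  degrees while sliding it from one leg of a minimum to the other (the corresponding changes at a
  maximum are compositions of these). In \<open>exchange\<close>, \<open>d\<close> is the number of vertical strands between
  the two pieces.
\<close>

inductive isotopy_change :: "layer list \<Rightarrow> layer list \<Rightarrow> bool" where
  exchange: "isotopy_change [(x, i), (y, i + strands_out x + d)]
                            [(y, i + strands_in x + d), (x, i)]"
| zigzag_left: "isotopy_change [(Cup, i), (Cap, i + 1)] []"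
| zigzag_right: "isotopy_change [(Cup, i + 1), (Cap, i)] []"
| turn: "is_crossing x \<or> is_marked x \<Longrightarrow>
     isotopy_change [(Cup, i), (x, i + 1)] [(Cup, i + 1), (quarter_turn x, i)]"

definition planar_isotopic :: "layer list \<Rightarrow> layer list \<Rightarrow> bool" where
  "planar_isotopic D D' \<longleftrightarrow> marked_graph_diagram D \<and> marked_graph_diagram D' \<and>
     equivclp (local_change isotopy_change) D D'"


subsection \<open>Yoshikawa moves\<close>

datatype yoshikawa =
  Gamma1 | Gamma2 | Gamma3 | Gamma4 | Gamma4' | Gamma5 | Gamma6 | Gamma6' | Gamma7 | Gamma8

text \<open>
  Since moves are applied up to planar isotopy, each is listed in one position only; its disc may
  be rotated. In \<open>Gamma3\<close> the parameters say which crossings are made by the three strands, \<open>x\<close>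
  being that of the first two (numbered from left to right at the bottom), \<open>y\<close> that of the outer
  two and \<open>z\<close> that of the last two; the side condition excludes exactly the two cases in which the
  strands lie cyclically above each other. \<open>Gamma5\<close> is rotated by 90 degrees (left becomes bottom).
\<close>

text \<open>
  In \<open>Gamma8\<close> the picture is rotated by 45 degrees: the horizontal pair runs from the bottom left
  to the top right, the vertical one from the bottom right to the top left. The arguments \<open>p\<close> and
  \<open>q\<close> tell at which end of the horizontal and the vertical pair, respectively, the marked vertex is
  inserted, true meaning the bottom one.
\<close>

definition pair_crossing :: "bool \<Rightarrow> bool \<Rightarrow> piece \<Rightarrow> nat \<Rightarrow> layer list" where
  "pair_crossing p q x i =
     (if p then [(Mark_V, i)] else []) @ (if q then [(Mark_H, i + 2)] else []) @
     [(x, i + 1), (x, i), (x, i + 2), (x, i + 1)] @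
     (if p then [] else [(Mark_V, i + 2)]) @ (if q then [] else [(Mark_H, i)])"

inductive yoshikawa_change :: "yoshikawa \<Rightarrow> layer list \<Rightarrow> layer list \<Rightarrow> bool" where
  "is_crossing x \<Longrightarrow> yoshikawa_change Gamma1 [(Cup, i), (x, i)] [(Cup, i)]"
| "is_crossing x \<Longrightarrow> yoshikawa_change Gamma2 [(x, i), (quarter_turn x, i)] []"
| "is_crossing x \<Longrightarrow> is_crossing y \<Longrightarrow> is_crossing z \<Longrightarrow> \<not> (x = z \<and> y \<noteq> x) \<Longrightarrow>
     yoshikawa_change Gamma3 [(x, i), (y, i + 1), (z, i)] [(z, i + 1), (y, i), (x, i + 1)]"
| "is_marked m \<Longrightarrow> yoshikawa_change Gamma4
     [(Over_NE, i), (Over_NE, i + 1), (m, i)] [(m, i + 1), (Over_NE, i), (Over_NE, i + 1)]"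
| "is_marked m \<Longrightarrow> yoshikawa_change Gamma4'
     [(Over_NW, i), (Over_NW, i + 1), (m, i)] [(m, i + 1), (Over_NW, i), (Over_NW, i + 1)]"
| "is_crossing x \<Longrightarrow> is_marked m \<Longrightarrow>
     yoshikawa_change Gamma5 [(x, i), (m, i)] [(m, i), (x, i)]"
| "yoshikawa_change Gamma6 [(Cup, i), (Mark_H, i)] [(Cup, i)]"
| "yoshikawa_change Gamma6' [(Cup, i), (Mark_V, i)] [(Cup, i)]"
| "yoshikawa_change Gamma7 [(Mark_H, i + 1), (Mark_V, i)] [(Mark_V, i), (Mark_H, i + 1)]"
| "yoshikawa_change Gamma8 (pair_crossing p q Over_NE i) (pair_crossing p q Over_NW i)"

text \<open>One application of a move, in either direction and anywhere in the plane.\<close>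

definition yoshikawa_move :: "yoshikawa \<Rightarrow> layer list \<Rightarrow> layer list \<Rightarrow> bool" where
  "yoshikawa_move g D D' \<longleftrightarrow> (\<exists>E E'. planar_isotopic D E \<and>
     (local_change (yoshikawa_change g) E E' \<or> local_change (yoshikawa_change g) E' E) \<and>
     planar_isotopic E' D')"


subsection \<open>Admissible diagrams\<close>

definition reidemeister_step :: "layer list \<Rightarrow> layer list \<Rightarrow> bool" where
  "reidemeister_step D D' \<longleftrightarrow> link_diagram D \<and> link_diagram D' \<and>
     (planar_isotopic D D' \<or> (\<exists>g \<in> {Gamma1, Gamma2, Gamma3}. yoshikawa_move g D D'))"

definition trivial_link_diagram :: "layer list \<Rightarrow> bool" where
  "trivial_link_diagram D \<longleftrightarrow>
     link_diagram D \<and> (\<exists>n\<ge>1. equivclp reidemeister_step D (circles n))"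

definition admissible :: "layer list \<Rightarrow> bool" where
  "admissible D \<longleftrightarrow> marked_graph_diagram D \<and>
     trivial_link_diagram (positive_resolution D) \<and>
     trivial_link_diagram (negative_resolution D)"


section \<open>The invariants\<close>

text \<open>
  The properties characterising the magma-valued function \<open>P\<close> of Niebrzydowski and Przytycki. They
  determine \<open>P\<close> on all nonempty link diagrams; its values elsewhere are irrelevant.
\<close>

definition bracket_invariant ::
    "('a \<Rightarrow> 'a \<Rightarrow> 'a) \<Rightarrow> (nat \<Rightarrow> 'a) \<Rightarrow> (layer list \<Rightarrow> 'a) \<Rightarrow> bool" where
  "bracket_invariant star a P \<longleftrightarrow>
     (\<forall>D D'. link_diagram D \<longrightarrow> link_diagram D' \<longrightarrow>
        planar_isotopic D D' \<or> yoshikawa_move Gamma2 D D' \<or> yoshikawa_move Gamma3 D D' \<longrightarrow>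
        P D = P D') \<and>
     (\<forall>n\<ge>1. P (circles n) = a n) \<and>
     (\<forall>u x i v. is_crossing x \<longrightarrow> link_diagram (u @ [(x, i)] @ v) \<longrightarrow>
        P (u @ [(x, i)] @ v) =
        star (P (u @ zero_smoothing x i @ v)) (P (u @ infty_smoothing x i @ v)))"

text \<open>
  \<open>P_M\<close> splices the marked vertices from bottom to top (\<open>u\<close> collects the layers already treated).
  For entropic \<open>bullet\<close> the order does not matter: see \<open>P_M_splice\<close> below.
\<close>

fun splice_markers ::
    "('a \<Rightarrow> 'a \<Rightarrow> 'a) \<Rightarrow> (layer list \<Rightarrow> 'a) \<Rightarrow> layer list \<Rightarrow> layer list \<Rightarrow> 'a" where
  "splice_markers bullet P u [] = P u"
| "splice_markers bullet P u ((x, i) # v) =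
     (if is_marked x
      then bullet (splice_markers bullet P (u @ infty_smoothing x i) v)
                  (splice_markers bullet P (u @ zero_smoothing x i) v)
      else splice_markers bullet P (u @ [(x, i)]) v)"

definition P_M :: "('a \<Rightarrow> 'a \<Rightarrow> 'a) \<Rightarrow> (layer list \<Rightarrow> 'a) \<Rightarrow> layer list \<Rightarrow> 'a" where
  "P_M bullet P D = splice_markers bullet P [] D"

lemma splice_markers_unmarked:
  "\<forall>(x, i) \<in> set w. \<not> is_marked x \<Longrightarrow>
     splice_markers bullet P u (w @ v) = splice_markers bullet P (u @ w) v"
  by (induction w arbitrary: u) auto

lemma smoothing_unmarked:
  assumes "is_marked x"
  shows "\<forall>(y, j) \<in> set (zero_smoothing x i). \<not> is_marked y"
    and "\<forall>(y, j) \<in> set (infty_smoothing x i). \<not> is_marked y"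
  using assms by (auto simp: is_marked_def)

lemma splice_markers_splice:
  assumes "entropic bullet" and m: "is_marked m"
  shows "splice_markers bullet P u (w @ [(m, i)] @ v) =
    bullet (splice_markers bullet P u (w @ infty_smoothing m i @ v))
           (splice_markers bullet P u (w @ zero_smoothing m i @ v))"
proof (induction w arbitrary: u)
  case Nil
  show ?case
    using m by (simp add: splice_markers_unmarked smoothing_unmarked)
next
  case (Cons l w)
  obtain x j where "l = (x, j)"
    by (cases l)
  then show ?case
    using Cons.IH assms(1) by (auto simp: entropic_def)
qed

lemma P_M_link_diagram: "link_diagram D \<Longrightarrow> P_M bullet P D = P D"
  using splice_markers_unmarked[of D bullet P "[]" "[]"]
  by (simp add: P_M_def link_diagram_def)

lemma P_M_splice:
  assumes "entropic bullet" and "is_marked m"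
  shows "P_M bullet P (u @ [(m, i)] @ v) =
    bullet (P_M bullet P (u @ infty_smoothing m i @ v)) (P_M bullet P (u @ zero_smoothing m i @ v))"
  unfolding P_M_def by (rule splice_markers_splice[OF assms])

definition invariant_under :: "(layer list \<Rightarrow> 'a) \<Rightarrow> yoshikawa \<Rightarrow> bool" where
  "invariant_under f g \<longleftrightarrow> (\<forall>D D'. admissible D \<longrightarrow> admissible D' \<longrightarrow>
     planar_isotopic D D' \<or> yoshikawa_move g D D' \<longrightarrow> f D = f D')"

end

(* Since a has period 2, P only sees the parity of the number of circles of a crossingless diagram.
   Orient the circles in checkerboard fashion; each has rotation number 1 or -1, so the parity is
   that of the total rotation number, which is a sum of local contributions of the minima and
   maxima. Hence P_M D is computed by letting the pieces of D act one after the other on functions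
   from parities to A: minima and maxima act by the identity or by the shift, a crossing by
   h |-> (p |-> h p * h (p + 1)), a marked vertex by the same map for the other operation, both
   possibly composed with the shift. By condition (2) all these operators commute, and the square of
   the crossing operator is the shift on every function obtained from a. So each of the moves in
   question, like each isotopy, visibly preserves the value. *)

theory Submission
  imports Defs
begin

section \<open>Tangles without markers\<close>

lemma tangle_append: "tangle m (u @ v) n \<longleftrightarrow> (\<exists>k. tangle m u k \<and> tangle k v n)"
proof (induction u arbitrary: m)
  case (Cons l u)
  then show ?case
    by (cases l) (simp only: tangle.simps append_Cons, blast)
qed simp

text \<open>Minima only add strands, so a nonempty closed diagram must contain a maximum.\<close>

lemma tangle_cups: "\<forall>l \<in> set u. fst l = Cup \<Longrightarrow> tangle m u n \<Longrightarrow> n = m + 2 * length u"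
  by (induction u arbitrary: m) force+

lemma tangle_smoothing:
  assumes "tangle m (u @ (x, i) # v) n" and "is_crossing x \<or> is_marked x"
  shows "tangle m (u @ zero_smoothing x i @ v) n" "tangle m (u @ infty_smoothing x i @ v) n"
proof -
  obtain k where k: "tangle m u k" and x: "tangle k ((x, i) # v) n"
    using assms(1) unfolding tangle_append by blast
  have "i + 2 \<le> k"
    using x assms(2) by (cases x) (auto simp: is_crossing_def is_marked_def)
  then obtain d where "k = i + 2 + d"
    unfolding le_iff_add by blast
  then have "tangle k (zero_smoothing x i @ v) n \<and> tangle k (infty_smoothing x i @ v) n"
    using x assms(2) by (cases x) (auto simp: is_crossing_def is_marked_def)
  then show "tangle m (u @ zero_smoothing x i @ v) n" "tangle m (u @ infty_smoothing x i @ v) n"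
    using k unfolding tangle_append[of m u] by blast+
qed

definition unmarked :: "layer list \<Rightarrow> bool" where
  "unmarked w \<longleftrightarrow> (\<forall>(x, i) \<in> set w. \<not> is_marked x)"

definition crossingless :: "layer list \<Rightarrow> bool" where
  "crossingless w \<longleftrightarrow> (\<forall>(x, i) \<in> set w. x = Cup \<or> x = Cap)"

lemma unmarked_simps [simp]:
  "unmarked []"
  "unmarked ((x, i) # w) \<longleftrightarrow> \<not> is_marked x \<and> unmarked w"
  "unmarked (u @ v) \<longleftrightarrow> unmarked u \<and> unmarked v"
  by (auto simp: unmarked_def)

lemma crossingless_simps [simp]:
  "crossingless []"
  "crossingless ((x, i) # w) \<longleftrightarrow> (x = Cup \<or> x = Cap) \<and> crossingless w"
  "crossingless (u @ v) \<longleftrightarrow> crossingless u \<and> crossingless v"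
  by (auto simp: crossingless_def)

lemma crossingless_unmarked: "crossingless w \<Longrightarrow> unmarked w"
  by (induction w) (auto simp: is_marked_def)

lemma link_diagram_iff: "link_diagram D \<longleftrightarrow> tangle 0 D 0 \<and> unmarked D"
  by (auto simp: link_diagram_def marked_graph_diagram_def unmarked_def)

lemma is_marked_simps [simp]:
  "\<not> is_marked Cup" "\<not> is_marked Cap" "\<not> is_marked Over_NE" "\<not> is_marked Over_NW"
  "is_marked Mark_H" "is_marked Mark_V"
  by (simp_all add: is_marked_def)

lemma is_crossing_simps [simp]:
  "\<not> is_crossing Cup" "\<not> is_crossing Cap" "is_crossing Over_NE" "is_crossing Over_NW"
  "\<not> is_crossing Mark_H" "\<not> is_crossing Mark_V"
  by (simp_all add: is_crossing_def)

lemma circles_Suc: "circles (Suc n) = [(Cup, 0), (Cap, 0)] @ circles n"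
  by (simp add: circles_def)

text \<open>In the checkerboard orientation, with strands at even positions pointing upwards, a minimum or
  maximum at position \<open>i\<close> contributes \<open>- (-1) ^ i / 2\<close> to the rotation number. As there are as many
  minima as maxima, adding 1/2 for each minimum and subtracting 1/2 for each maximum changes nothing
  and makes all contributions integers.\<close>

fun circle_parity :: "layer list \<Rightarrow> bool" where
  "circle_parity [] = False"
| "circle_parity ((x, i) # w) =
     ((x = Cup \<and> odd i \<or> x = Cap \<and> even i) \<noteq> circle_parity w)"

lemma circle_parity_append [simp]:
  "circle_parity (u @ v) = (circle_parity u \<noteq> circle_parity v)"
  by (induction u) auto


section \<open>Crossingless diagrams\<close>

text \<open>\<open>same P l r\<close> is directed: \<open>r\<close> may replace \<open>l\<close> wherever \<open>l\<close> fits.\<close>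

definition same :: "(layer list \<Rightarrow> 'a) \<Rightarrow> layer list \<Rightarrow> layer list \<Rightarrow> bool" where
  "same P l r \<longleftrightarrow> (\<forall>u v. link_diagram (u @ l @ v) \<longrightarrow>
     link_diagram (u @ r @ v) \<and> P (u @ l @ v) = P (u @ r @ v))"

lemma same_refl [simp]: "same P l l"
  by (simp add: same_def)

lemma same_trans [trans]: "same P l r \<Longrightarrow> same P r s \<Longrightarrow> same P l s"
  by (simp add: same_def)

lemma same_context: "same P l r \<Longrightarrow> same P (s @ l @ t) (s @ r @ t)"
  unfolding same_def by (metis append.assoc)

locale bracket =
  fixes star :: "'a \<Rightarrow> 'a \<Rightarrow> 'a" and a :: "nat \<Rightarrow> 'a" and P :: "layer list \<Rightarrow> 'a"
  assumes bracket: "bracket_invariant star a P"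
begin

text \<open>The frames \<open>s\<close> and \<open>t\<close> supply the strands that
  \<open>r\<close> needs when \<open>l\<close> is empty, as when a zigzag or a \<open>Gamma2\<close>
  pair is created; hence only the framed tangle is required to fit.\<close>

lemma same_local:
  assumes R: "isotopy_change l r \<or> isotopy_change r l \<or>
      yoshikawa_change Gamma2 l r \<or> yoshikawa_change Gamma2 r l"
    and t: "\<And>m n. tangle m (s @ l @ t) n \<Longrightarrow> tangle m (s @ r @ t) n"
    and r: "unmarked r"
  shows "same P (s @ l @ t) (s @ r @ t)"
  unfolding same_def
proof (intro allI impI)
  fix u v
  let ?D = "u @ (s @ l @ t) @ v" and ?D' = "u @ (s @ r @ t) @ v"
  assume D: "link_diagram ?D"
  have D': "link_diagram ?D'"
    using D t r unfolding link_diagram_iff tangle_append[of _ u] tangle_append[of _ _ v]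
    by auto
  have g: "marked_graph_diagram ?D" "marked_graph_diagram ?D'"
    using D D' by (auto simp: link_diagram_def)
  have lc: "local_change R ?D ?D'" if "R l r" for R
    unfolding local_change_def using g that by (metis append.assoc)
  have lc': "local_change R ?D' ?D" if "R r l" for R
    unfolding local_change_def using g that by (metis append.assoc)
  have refl: "planar_isotopic E E" if "marked_graph_diagram E" for E
    using that by (simp add: planar_isotopic_def)
  have "planar_isotopic ?D ?D' \<or> yoshikawa_move Gamma2 ?D ?D'"
  proof (cases "isotopy_change l r \<or> isotopy_change r l")
    case True
    then show ?thesis
      using lc[of isotopy_change] lc'[of isotopy_change] g
      by (auto simp: planar_isotopic_def intro: r_into_equivclp converse_r_into_equivclp)
  next
    case False
    then have "local_change (yoshikawa_change Gamma2) ?D ?D' \<or>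
        local_change (yoshikawa_change Gamma2) ?D' ?D"
      using R lc[of "yoshikawa_change Gamma2"] lc'[of "yoshikawa_change Gamma2"] by blast
    then show ?thesis
      unfolding yoshikawa_move_def using g refl by blast
  qed
  then show "link_diagram ?D' \<and> P ?D = P ?D'"
    using bracket D D' unfolding bracket_invariant_def by blast
qed

lemmas same_local' = same_local[where s = "[]" and t = "[]", simplified]

lemma same_exchange:
  assumes "\<not> is_marked x" "\<not> is_marked y"
  shows "same P [(x, i), (y, i + strands_out x + d)] [(y, i + strands_in x + d), (x, i)]"
    and "same P [(y, i + strands_in x + d), (x, i)] [(x, i), (y, i + strands_out x + d)]"
  using assms by (auto intro!: same_local' exchange)

lemma same_zigzag:
  "same P [(Cup, i), (Cap, i + 1)] []" "same P [(Cup, i + 1), (Cap, i)] []"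
  using zigzag_left[of i] zigzag_right[of i] by (auto intro!: same_local')

lemma same_turn:
  assumes "is_crossing x"
  shows "same P [(Cup, i), (x, i + 1)] [(Cup, i + 1), (quarter_turn x, i)]"
proof (rule same_local')
  show "tangle m [(Cup, i + 1), (quarter_turn x, i)] n" if "tangle m [(Cup, i), (x, i + 1)] n"
    for m n
    using that assms by (cases x) auto
  show "unmarked [(Cup, i + 1), (quarter_turn x, i)]"
    using assms by (cases x) auto
qed (use assms turn[of x i] in blast)

lemma same_Gamma2:
  assumes "is_crossing x"
  shows "same P [(x, i), (quarter_turn x, i)] []"
proof (rule same_local')
  show "tangle m [] n" if "tangle m [(x, i), (quarter_turn x, i)] n" for m n
    using that assms by (cases x) auto
qed (use assms yoshikawa_change.intros(2)[of x i] in auto)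

text \<open>The turn is given at minima only. A zigzag in the strand entering \<open>x\<close> at
  the bottom left provides a minimum; after the turn there, the zigzag left on the other side is
  straightened.\<close>

lemma same_cap_turn:
  assumes "is_crossing x"
  shows "same P [(x, i), (Cap, i + 1)] [(quarter_turn x, i + 1), (Cap, i)]"
proof -
  let ?y = "quarter_turn x"
  have xy [simp]: "\<not> is_marked x" "\<not> is_marked ?y" "strands_in x = 2" "strands_in ?y = 2"
    "strands_out x = 2" "strands_out ?y = 2"
    using assms by (cases x; simp)+
  have "same P [(x, i), (Cap, i + 1)] [(Cup, i + 1), (Cap, i), (x, i), (Cap, i + 1)]"
    using same_local[of "[]" "[(Cup, i + 1), (Cap, i)]" "[]" "[(x, i), (Cap, i + 1)]"]
    by (auto intro: zigzag_right[simplified])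
  also have "same P \<dots> [(Cup, i + 1), (x, i + 2), (Cap, i), (Cap, i + 1)]"
    using same_context[OF same_exchange(1)[of Cap x i 0], of "[(Cup, i + 1)]" "[(Cap, i + 1)]"]
    by simp
  also have "same P \<dots> [(Cup, i + 2), (?y, i + 1), (Cap, i), (Cap, i + 1)]"
    using same_context[OF same_turn[OF assms, of "i + 1"], of "[]" "[(Cap, i), (Cap, i + 1)]"]
    by simp
  also have "same P \<dots> [(Cup, i + 2), (?y, i + 1), (Cap, i + 3), (Cap, i)]"
    using same_context[OF same_exchange(1)[of Cap Cap i 1], of "[(Cup, i + 2), (?y, i + 1)]" "[]"]
    by (simp add: numeral_3_eq_3)
  also have "same P \<dots> [(Cup, i + 2), (Cap, i + 3), (?y, i + 1), (Cap, i)]"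
    using same_context[OF same_exchange(1)[of ?y Cap "i + 1" 0], of "[(Cup, i + 2)]" "[(Cap, i)]"]
    by (simp add: numeral_3_eq_3)
  also have "same P \<dots> [(?y, i + 1), (Cap, i)]"
    using same_context[OF same_zigzag(1)[of "i + 2"], of "[]" "[(?y, i + 1), (Cap, i)]"]
    by (simp add: numeral_3_eq_3)
  finally show ?thesis .
qed

text \<open>A small circle slides past a vertical strand by two moves of type \<open>Gamma2\<close>; so nesting does
  not matter.\<close>

lemma same_circle_left:
  "same P [(Cup, i + 1), (Cap, i + 1)] [(Cup, i), (Cap, i)]"
proof -
  \<comment> \<open>The strand is pulled across the left leg of the circle; turning the crossings at
    the maximum and at the minimum moves them to the right leg, where they cancel.\<close>
  have "same P [(Cup, i + 1), (Cap, i + 1)]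
      [(Cup, i + 1), (Over_NW, i), (Over_NE, i), (Cap, i + 1)]"
    using same_local[of "[]" "[(Over_NW, i), (quarter_turn Over_NW, i)]" "[(Cup, i + 1)]"
        "[(Cap, i + 1)]"]
    by (auto intro: yoshikawa_change.intros(2)[of Over_NW, simplified])
  also have "same P \<dots> [(Cup, i + 1), (Over_NW, i), (Over_NW, i + 1), (Cap, i)]"
    using same_context[OF same_cap_turn[of Over_NE i], of "[(Cup, i + 1), (Over_NW, i)]" "[]"]
    by simp
  also have "same P \<dots> [(Cup, i), (Over_NE, i + 1), (Over_NW, i + 1), (Cap, i)]"
    using same_local[of "[(Cup, i + 1), (Over_NW, i)]" "[(Cup, i), (Over_NE, i + 1)]" "[]"
        "[(Over_NW, i + 1), (Cap, i)]"] turn[of Over_NE i]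
    by auto
  also have "same P \<dots> [(Cup, i), (Cap, i)]"
    using same_context[OF same_Gamma2[of Over_NE "i + 1"], of "[(Cup, i)]" "[(Cap, i)]"]
    by simp
  finally show ?thesis .
qed

lemma same_circle_leftmost: "same P [(Cup, i), (Cap, i)] [(Cup, 0), (Cap, 0)]"
proof (induction i)
  case (Suc i)
  then show ?case
    using same_trans[OF same_circle_left[of i]] by simp
qed simp

text \<open>With the circle at position 0, every piece of \<open>u\<close> lies wholly to its right
  and can exchange heights with it.\<close>

lemma same_circle_down:
  assumes "unmarked u"
  shows "same P (u @ [(Cup, 0), (Cap, 0)]) ([(Cup, 0), (Cap, 0)] @ u)"
  using assms
proof (induction u rule: rev_induct)
  case (snoc l u)
  obtain y d where l: "l = (y, d)"
    by (cases l)
  have y: "\<not> is_marked y" and u: "unmarked u"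
    using snoc.prems l by auto
  have "same P (u @ [l] @ [(Cup, 0), (Cap, 0)]) (u @ [(Cup, 0), (y, d + 2), (Cap, 0)])"
    using same_context[OF same_exchange(2)[of Cup y 0 d], of u "[(Cap, 0)]"] y l
    by simp
  also have "same P \<dots> (u @ [(Cup, 0), (Cap, 0), l])"
    using same_context[OF same_exchange(2)[of Cap y 0 d], of "u @ [(Cup, 0)]" "[]"] y l
    by simp
  also have "same P \<dots> ([(Cup, 0), (Cap, 0)] @ u @ [l])"
    using same_context[OF snoc.IH[OF u], of "[]" "[l]"] by simp
  finally show ?case
    by simp
qed simp

text \<open>The lowest maximum is pushed down until it cancels a minimum or completes a circle.\<close>

lemma reduce_lowest_cap:
  assumes "\<forall>l \<in> set u. fst l = Cup" and "tangle 0 (u @ (Cap, j) # v) 0" and "crossingless v"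
  shows "\<exists>D'. crossingless D' \<and> tangle 0 D' 0 \<and> length D' < length (u @ (Cap, j) # v) \<and>
    (same P (u @ (Cap, j) # v) D' \<and> D' \<noteq> [] \<and>
       circle_parity (u @ (Cap, j) # v) = circle_parity D' \<or>
     same P (u @ (Cap, j) # v) ([(Cup, 0), (Cap, 0)] @ D') \<and>
       circle_parity (u @ (Cap, j) # v) = (\<not> circle_parity D'))"
  using assms
proof (induction u arbitrary: j v rule: rev_induct)
  case Nil
  then show ?case by simp
next
  case (snoc l u)
  obtain i where l: "l = (Cup, i)"
    using snoc.prems(1) by (cases l) auto
  have cu: "\<forall>l \<in> set u. fst l = Cup" and u: "crossingless u"
    using snoc.prems(1) by (auto simp: crossingless_def)
  let ?D = "(u @ [l]) @ (Cap, j) # v"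
  have link: "link_diagram ?D"
    using snoc.prems u crossingless_unmarked by (auto simp: link_diagram_iff l)
  have closed: "tangle 0 D' 0" if "same P ?D D'" for D'
    using that link unfolding same_def link_diagram_iff
    by (metis append_Nil append_Nil2)
  \<comment> \<open>The maximum closes both legs, one leg or no leg of the minimum just below
    it.\<close>
  consider (circle) "j = i" | (zigzag) "j = i + 1 \<or> i = j + 1"
    | (right) d where "j = i + 2 + d" | (left) d where "i = j + 2 + d"
  proof -
    have "j = i \<or> (j = i + 1 \<or> i = j + 1) \<or> i + 2 \<le> j \<or> j + 2 \<le> i"
      by linarith
    then show thesis
      using that unfolding le_iff_add by blast
  qed
  then show ?case
  proof cases
    case circle
    have "same P ?D (u @ [(Cup, 0), (Cap, 0)] @ v)"
      using same_context[OF same_circle_leftmost[of i], of u v] circle l by simp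
    also have "same P \<dots> ([(Cup, 0), (Cap, 0)] @ u @ v)"
      using same_context[OF same_circle_down[of u], of "[]" v] u crossingless_unmarked by simp
    finally have s: "same P ?D ([(Cup, 0), (Cap, 0)] @ u @ v)" .
    then have "tangle 0 (u @ v) 0"
      using closed by fastforce
    then show ?thesis
      using s u snoc.prems(3) circle l by (intro exI[of _ "u @ v"]) auto
  next
    case zigzag
    then have "same P [l, (Cap, j)] []"
      using same_zigzag l by auto
    then have s: "same P ?D (u @ v)"
      using same_context[of P "[l, (Cap, j)]" "[]" u v] by simp
    \<comment> \<open>A zigzag needs a third strand, so it is not the whole diagram. This matters
      because \<open>P\<close> is prescribed on \<open>circles n\<close> only for
      \<open>n \<ge> 1\<close>.\<close>
    have "u @ v \<noteq> []"
      using snoc.prems(2) zigzag l by auto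
    then show ?thesis
      using s closed[OF s] u snoc.prems(3) zigzag l by (intro exI[of _ "u @ v"]) auto
  next
    case right
    \<comment> \<open>The exchange moves one position by 2, which keeps the parity, and the minimum
      joins \<open>v\<close> for the induction hypothesis.\<close>
    have s: "same P ?D (u @ (Cap, i + d) # (Cup, i) # v)"
      using same_context[OF same_exchange(1)[of Cup Cap i d], of u v] right l by simp
    show ?thesis
      using snoc.IH[OF cu closed[OF s]] snoc.prems(3) same_trans[OF s] right l by auto
  next
    case left
    have s: "same P ?D (u @ (Cap, j) # (Cup, j + d) # v)"
      using same_context[OF same_exchange(2)[of Cap Cup j d], of u v] left l by simp
    show ?thesis
      using snoc.IH[OF cu closed[OF s]] snoc.prems(3) same_trans[OF s] left l by auto
  qed
qed

text \<open>Each reduction shortens the diagram and either keeps the parity and nonemptiness or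
  splits off a circle and flips the parity.\<close>

lemma same_circles:
  assumes "crossingless D" and "tangle 0 D 0"
  shows "\<exists>k. same P D (circles k) \<and> circle_parity D = odd k \<and> (D \<noteq> [] \<longrightarrow> k \<ge> 1)"
  using assms
proof (induction "length D" arbitrary: D rule: less_induct)
  case less
  show ?case
  proof (cases "D = []")
    case True
    then show ?thesis
      by (intro exI[of _ 0]) (simp add: circles_def)
  next
    case False
    have "\<exists>l \<in> set D. fst l \<noteq> Cup"
      using tangle_cups[of D 0 0] less.prems(2) False by auto
    then obtain u l v where D: "D = u @ l # v" and "fst l \<noteq> Cup" and u: "\<forall>l \<in> set u. fst l = Cup"
      using split_list_first_prop[of D "\<lambda>l. fst l \<noteq> Cup"] by auto
    then obtain j where l: "l = (Cap, j)" and v: "crossingless v"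
      using less.prems(1) by (cases l) auto
    obtain D' where D': "crossingless D'" "tangle 0 D' 0" "length D' < length D"
      and alt: "same P D D' \<and> D' \<noteq> [] \<and> circle_parity D = circle_parity D' \<or>
        same P D ([(Cup, 0), (Cap, 0)] @ D') \<and> circle_parity D = (\<not> circle_parity D')"
      using reduce_lowest_cap[OF u _ v, of j] less.prems(2) D l by auto
    obtain k where k: "same P D' (circles k)" "circle_parity D' = odd k" "D' \<noteq> [] \<longrightarrow> k \<ge> 1"
      using less.hyps[OF D'(3,1,2)] by blast
    from alt show ?thesis
    proof
      assume "same P D D' \<and> D' \<noteq> [] \<and> circle_parity D = circle_parity D'"
      then show ?thesis
        using k same_trans by blast
    next
      assume "same P D ([(Cup, 0), (Cap, 0)] @ D') \<and> circle_parity D = (\<not> circle_parity D')"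
      then show ?thesis
        using k same_trans same_context[OF k(1), of "[(Cup, 0), (Cap, 0)]" "[]"]
        by (intro exI[of _ "Suc k"]) (auto simp: circles_Suc)
    qed
  qed
qed

end


section \<open>The state sum\<close>

locale periodic_bracket = bracket star a P
  for star :: "'a \<Rightarrow> 'a \<Rightarrow> 'a" and a :: "nat \<Rightarrow> 'a" and P :: "layer list \<Rightarrow> 'a" +
  fixes bullet :: "'a \<Rightarrow> 'a \<Rightarrow> 'a"
  assumes magma: "marked_Kauffman_bracket_magma star bullet a"
    and periodic: "\<And>n. n \<ge> 1 \<Longrightarrow> a n = a (n + 2)"
    and interchange: "\<And>b c d e. bullet (star b c) (star d e) = star (bullet b d) (bullet c e)"
begin

lemma bullet_entropic: "bullet (bullet b c) (bullet d e) = bullet (bullet b d) (bullet c e)"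
  using magma by (simp add: marked_Kauffman_bracket_magma_def entropic_def)

text \<open>\<open>True\<close> stands for odd; the even class is represented by \<open>a 2\<close>
  because indices start at 1.\<close>

definition parity_value :: "bool \<Rightarrow> 'a" where
  "parity_value p = (if p then a 1 else a 2)"

lemma a_eq_parity_value: "n \<ge> 1 \<Longrightarrow> a n = parity_value (odd n)"
proof (induction n rule: less_induct)
  case (less n)
  show ?case
  proof (cases "n \<le> 2")
    case True
    then have "n = 1 \<or> n = 2"
      using less.prems by auto
    then show ?thesis
      by (auto simp: parity_value_def)
  next
    case False
    then have "n = n - 2 + 2" "n - 2 \<ge> 1"
      by simp_all
    then obtain m where "n = m + 2" "m \<ge> 1"
      by blast
    then show ?thesis
      using less.IH[of m] periodic[of m] by auto
  qed
qed

lemma P_crossingless: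
  assumes "crossingless D" "tangle 0 D 0" "D \<noteq> []"
  shows "P D = parity_value (circle_parity D)"
proof -
  obtain k where k: "same P D (circles k)" "circle_parity D = odd k" "k \<ge> 1"
    using same_circles[OF assms(1,2)] assms(3) by blast
  have "P D = P (circles k)"
    using k(1) assms(1,2) crossingless_unmarked unfolding same_def link_diagram_iff
    by (metis append_Nil append_Nil2)
  also have "\<dots> = a k"
    using bracket k(3) by (simp add: bracket_invariant_def)
  finally show ?thesis
    using a_eq_parity_value k by simp
qed

text \<open>Here \<open>h\<close> evaluates the layers above, given the parity accumulated below. A
  turnback at any position flips this parity and vertical strands keep it, whence the arguments
  \<open>h (\<not> p)\<close> and \<open>h p\<close>.\<close>

fun act :: "layer \<Rightarrow> (bool \<Rightarrow> 'a) \<Rightarrow> bool \<Rightarrow> 'a" where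
  "act (Cup, i) h p = h (p \<noteq> odd i)"
| "act (Cap, i) h p = h (p \<noteq> even i)"
| "act (Over_NE, i) h p = star (h p) (h (\<not> p))"
| "act (Over_NW, i) h p = star (h (\<not> p)) (h p)"
| "act (Mark_H, i) h p = bullet (h (\<not> p)) (h p)"
| "act (Mark_V, i) h p = bullet (h p) (h (\<not> p))"

abbreviation state_sum :: "layer list \<Rightarrow> bool \<Rightarrow> 'a" where
  "state_sum D \<equiv> foldr act D parity_value"

text \<open>Crossings are smoothed from bottom to top; the part \<open>u\<close> already smoothed
  enters only through its parity.\<close>

lemma P_state_sum:
  assumes "crossingless u" "unmarked v" "tangle 0 (u @ v) 0" "u @ v \<noteq> []"
  shows "P (u @ v) = state_sum v (circle_parity u)"
  using assms
proof (induction v arbitrary: u)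
  case Nil
  then show ?case by (simp add: P_crossingless)
next
  case (Cons l v)
  obtain x i where l: "l = (x, i)"
    by (cases l)
  show ?case
  proof (cases "is_crossing x")
    case True
    then have sm: "tangle 0 ((u @ zero_smoothing x i) @ v) 0"
        "tangle 0 ((u @ infty_smoothing x i) @ v) 0"
      using tangle_smoothing Cons.prems(3) l by fastforce+
    have cl: "crossingless (u @ zero_smoothing x i)" "crossingless (u @ infty_smoothing x i)"
      using True Cons.prems(1) by (cases x; auto)+
    \<comment> \<open>A crossing has strands entering from below, so \<open>u\<close> contains a
      minimum and both smoothed diagrams are nonempty.\<close>
    have ne: "u \<noteq> []"
      using True Cons.prems(3) l by (cases x) auto
    have "link_diagram (u @ [(x, i)] @ v)"
      using Cons.prems l crossingless_unmarked by (auto simp: link_diagram_iff)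
    then have "P (u @ [l] @ v) =
        star (P (u @ zero_smoothing x i @ v)) (P (u @ infty_smoothing x i @ v))"
      using bracket True l unfolding bracket_invariant_def by blast
    also have "\<dots> = star (state_sum v (circle_parity (u @ zero_smoothing x i)))
        (state_sum v (circle_parity (u @ infty_smoothing x i)))"
      using Cons.IH[OF cl(1) _ sm(1)] Cons.IH[OF cl(2) _ sm(2)] Cons.prems(2) l ne
      by (simp del: circle_parity_append)
    also have "\<dots> = state_sum (l # v) (circle_parity u)"
      using True l by (cases x) auto
    finally show ?thesis by simp
  next
    case False
    then have x: "x = Cup \<or> x = Cap"
      using Cons.prems(2) l by (cases x) auto
    have "P ((u @ [l]) @ v) = state_sum v (circle_parity (u @ [l]))"
      using Cons.prems x l by (intro Cons.IH) auto
    also have "\<dots> = state_sum (l # v) (circle_parity u)"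
      using x l by auto
    finally show ?thesis by simp
  qed
qed

text \<open>The splice passes crossings below it by \<open>interchange\<close> and marked vertices
  below it by entropicity of \<open>bullet\<close>.\<close>

lemma state_sum_splice:
  assumes "is_marked m"
  shows "state_sum (u @ (m, i) # v) p =
    bullet (state_sum (u @ infty_smoothing m i @ v) p) (state_sum (u @ zero_smoothing m i @ v) p)"
proof (induction u arbitrary: p)
  case Nil
  then show ?case
    using assms by (cases m; cases "even i"; cases p) auto
next
  case (Cons l u)
  then show ?case
    by (cases l; cases "fst l") (auto simp: interchange intro: bullet_entropic)
qed

lemma splice_markers_state_sum:
  assumes "unmarked u" "tangle 0 (u @ v) 0" "u @ v \<noteq> []"
  shows "splice_markers bullet P u v = state_sum (u @ v) False"
  using assms
proof (induction v arbitrary: u)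
  case Nil
  then show ?case
    using P_state_sum[of "[]" u] by simp
next
  case (Cons l v)
  obtain x i where l: "l = (x, i)"
    by (cases l)
  show ?case
  proof (cases "is_marked x")
    case True
    then have sm: "tangle 0 ((u @ zero_smoothing x i) @ v) 0"
        "tangle 0 ((u @ infty_smoothing x i) @ v) 0"
      using tangle_smoothing Cons.prems(2) l by fastforce+
    have um: "unmarked (u @ zero_smoothing x i)" "unmarked (u @ infty_smoothing x i)"
      using True Cons.prems(1) by (cases x; auto)+
    have "u \<noteq> []"
      using True Cons.prems(2) l by (cases x) auto
    then show ?thesis
      using Cons.IH[OF um(1) sm(1)] Cons.IH[OF um(2) sm(2)] True l
        state_sum_splice[OF True, of u i v] by simp
  next
    case False
    then show ?thesis
      using Cons.IH[of "u @ [l]"] Cons.prems l by simp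
  qed
qed

lemma P_M_state_sum:
  "marked_graph_diagram D \<Longrightarrow> D \<noteq> [] \<Longrightarrow> P_M bullet P D = state_sum D False"
  using splice_markers_state_sum[of "[]" D] by (simp add: P_M_def marked_graph_diagram_def)


section \<open>Invariance\<close>

text \<open>This is what \<open>Gamma2\<close> needs. The identity passes a crossing by using it for
  both parities, and a marked vertex by \<open>interchange\<close>; minima and maxima at most swap
  the parities.\<close>

lemma state_sum_involution:
  "star (star (state_sum w p) (state_sum w (\<not> p))) (star (state_sum w (\<not> p)) (state_sum w p)) =
     state_sum w (\<not> p)"
proof (induction w arbitrary: p)
  case Nil
  have K: "star (star (a n) (a (n + 1))) (star (a (n + 1)) (a n)) = a (n + 1)" if "n \<ge> 1" for n
    using magma that by (simp add: marked_Kauffman_bracket_magma_def Kauffman_bracket_magma_def)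
  \<comment> \<open>With this, the magma identity at 1 and at 2 is the claim for \<open>p\<close>
    true and false.\<close>
  have "a 3 = a 1"
    using periodic[of 1] by (simp add: numeral_3_eq_3)
  then show ?case
    using K[of 1] K[of 2] by (auto simp: parity_value_def numeral_2_eq_2 numeral_3_eq_3)
next
  case (Cons l w)
  have "star (star (state_sum w (\<not> p)) (state_sum w p))
      (star (state_sum w p) (state_sum w (\<not> p))) = state_sum w p" for p
    using Cons.IH[of "\<not> p"] by simp
  then show ?case
    using Cons.IH interchange[symmetric]
    by (cases l; cases "fst l"; cases "even (snd l)") auto
qed

text \<open>Up to parity shifts, which commute with everything, there is one operator for
  \<open>star\<close> and one for \<open>bullet\<close>; these two commute by
  \<open>interchange\<close>.\<close>

lemma act_commute: "act (x, i) (act (y, j) h) = act (y, j) (act (x, i) h)"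
  by (rule ext; cases x; cases y; cases "even i"; cases "even j") (auto simp: interchange)

lemma act_position_even: "act (x, i + 2) = act (x, i)"
  by (intro ext; cases x) auto

lemma act_position_crossing: "is_crossing x \<Longrightarrow> act (x, i) = act (x, j)"
  by (intro ext; cases x) auto

lemma isotopy_change_act: "isotopy_change l r \<Longrightarrow> foldr act l h = foldr act r h"
proof (induction rule: isotopy_change.induct)
  case (exchange x i y d)
  \<comment> \<open>The numbers of strands entering and leaving \<open>x\<close> differ by an even
    number.\<close>
  have "act (y, i + strands_out x + d) = act (y, i + strands_in x + d)"
    using act_position_even[of y "i + d"] by (cases x) (auto simp: add.commute add.left_commute)
  then show ?case
    by (simp add: act_commute)
next
  \<comment> \<open>The quarter turn adds a parity shift, and so does moving the minimum by one
    position.\<close>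
  case (turn x i)
  then show ?case
    by (intro ext; cases x; cases "even i") (auto simp: is_crossing_def is_marked_def)
next
  case (zigzag_left i)
  then show ?case
    by (cases "even i") (auto simp: fun_eq_iff)
next
  case (zigzag_right i)
  then show ?case
    by (cases "even i") (auto simp: fun_eq_iff)
qed

text \<open>Apart from \<open>Gamma2\<close> and \<open>Gamma8\<close>, both sides consist of the
  same crossings and marked vertices, whose operators commute and do not depend on position.\<close>

lemma yoshikawa_change_state_sum:
  "yoshikawa_change g l r \<Longrightarrow> g \<notin> {Gamma1, Gamma6, Gamma6'} \<Longrightarrow>
     state_sum (l @ v) = state_sum (r @ v)"
proof (induction rule: yoshikawa_change.induct)
  case (2 x i)
  then show ?case
    using state_sum_involution[of v "\<not> p" for p]
    by (intro ext; cases x) auto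
next
  case (3 x y z i)
  then have "act (x, i + 1) = act (x, i)" "act (y, i + 1) = act (y, i)"
    "act (z, i + 1) = act (z, i)"
    using act_position_crossing by blast+
  then show ?case
    by (simp add: act_commute)
next
  \<comment> \<open>Changing four crossings inserts four parity shifts, which cancel.\<close>
  case (10 p q i)
  show ?case
    by (intro ext; cases p; cases q) (auto simp: pair_crossing_def interchange)
qed (auto simp: fun_eq_iff is_crossing_def is_marked_def interchange)

text \<open>The state sum formula excludes the empty diagram, so no change may create or erase a
  whole diagram; a zigzag or a \<open>Gamma2\<close> pair has open ends and cannot be one.\<close>

lemma local_change_nonempty:
  assumes "local_change R D D'"
    and "\<And>l r. R l r \<Longrightarrow> l = [] \<or> r = [] \<Longrightarrow> \<not> tangle 0 l 0 \<or> \<not> tangle 0 r 0"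
  shows "D = [] \<longleftrightarrow> D' = []"
  using assms by (force simp: local_change_def marked_graph_diagram_def)

lemma isotopy_nonempty: "local_change isotopy_change D D' \<Longrightarrow> D = [] \<longleftrightarrow> D' = []"
  by (erule local_change_nonempty) (auto elim!: isotopy_change.cases)

lemma yoshikawa_nonempty: "local_change (yoshikawa_change g) D D' \<Longrightarrow> D = [] \<longleftrightarrow> D' = []"
  by (erule local_change_nonempty)
    (auto elim!: yoshikawa_change.cases simp: pair_crossing_def is_crossing_def)

lemma P_M_eqI:
  assumes "marked_graph_diagram D" "marked_graph_diagram D'" "D = [] \<longleftrightarrow> D' = []"
    "state_sum D = state_sum D'"
  shows "P_M bullet P D = P_M bullet P D'"
  using assms P_M_state_sum by (cases "D = []") auto

lemma P_M_isotopic: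
  assumes "planar_isotopic D D'"
  shows "P_M bullet P D = P_M bullet P D'"
proof -
  have step: "P_M bullet P E = P_M bullet P F" if "local_change isotopy_change E F" for E F
  proof (rule P_M_eqI)
    show "state_sum E = state_sum F"
      using that isotopy_change_act by (force simp: local_change_def)
  qed (use that isotopy_nonempty in \<open>auto simp: local_change_def\<close>)
  have "equivclp (local_change isotopy_change) D D'"
    using assms by (simp add: planar_isotopic_def)
  then show ?thesis
    by (induction rule: equivclp_induct) (auto dest: step)
qed

lemma P_M_yoshikawa:
  assumes "yoshikawa_move g D D'" "g \<notin> {Gamma1, Gamma6, Gamma6'}"
  shows "P_M bullet P D = P_M bullet P D'"
proof -
  have step: "P_M bullet P E = P_M bullet P F" if lc: "local_change (yoshikawa_change g) E F" for E F
  proof (rule P_M_eqI)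
    obtain u v l r where "yoshikawa_change g l r" and EF: "E = u @ l @ v" "F = u @ r @ v"
      using lc unfolding local_change_def by blast
    then have "state_sum (l @ v) = state_sum (r @ v)"
      using yoshikawa_change_state_sum assms(2) by blast
    then show "state_sum E = state_sum F"
      by (simp add: EF)
  qed (use lc yoshikawa_nonempty[OF lc] in \<open>auto simp: local_change_def\<close>)
  show ?thesis
    using assms(1) unfolding yoshikawa_move_def by (metis P_M_isotopic step)
qed

end

theorem theorem4p1:
  fixes star bullet :: "'a \<Rightarrow> 'a \<Rightarrow> 'a"
    and a :: "nat \<Rightarrow> 'a"
    and P :: "layer list \<Rightarrow> 'a"
  assumes "marked_Kauffman_bracket_magma star bullet a"
    and "\<And>n. n \<ge> 1 \<Longrightarrow> a n = a (n + 2)"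
    and "\<And>b c d e. bullet (star b c) (star d e) = star (bullet b d) (bullet c e)"
    and "bracket_invariant star a P"
  shows "\<forall>g. g \<notin> {Gamma1, Gamma6, Gamma6'} \<longrightarrow> invariant_under (P_M bullet P) g"
proof -
  interpret periodic_bracket star a P bullet
    using assms by unfold_locales
  show ?thesis
    unfolding invariant_under_def using P_M_isotopic P_M_yoshikawa by blast
qed

end
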